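(* Let $T>0$, $u\in L^\infty(0,T)$ and $W^0\in\widehat H^0(\mathbb R^2)$. Then: (i) $\mathcal W_0(\cdot,t)\in\widehat H^0(\mathbb R^2)$ for $t\in[0,T]$; (ii) $\mathcal W_0(\cdot,t)\in C^\infty(\mathbb R^2)$ for $t\in(0,T]$; (iii) if $W^0\in\mathcal H$, then $\mathcal W_0(\cdot,t)\in\mathcal H$ for $t\in[0,T]$; (iv) $\mathcal W_u(\cdot,t)\in\mathcal H$ and $\|\mathcal W_u(\cdot,t)\|_{L^2(\mathbb R^2)}\le\frac{2}{\sqrt\pi}(t+1)\|u\|_{L^\infty(0,T)}$ for $t\in[0,T]$.
   Context: $\mathbb R_+=(0,+\infty)$; function spaces are complex. $\widehat H^0(\mathbb R^2)$ is the subspace of $L^2(\mathbb R^2)$ of functions even with respect to $x_1$. $\mathcal H=\{f\in L^2(\mathbb R^2): \exists g\in L^2(\mathbb R_+),\ f(x)=g(|x|^2)\text{ a.e. on }\mathbb R^2\}$. For $W^0\in\widehat H^0(\mathbb R^2)$ and $u\in L^\infty(0,T)$, $$\mathcal W_0(\cdot,t)=\frac1{4\pi t}e^{-\frac{|\cdot|^2}{4t}}*W^0\ (t\in(0,T]),\quad \mathcal W_0(\cdot,0)=W^0,\qquad \mathcal W_u(x,t)=-\frac1\pi\int_0^t\frac1{2\xi}e^{-\frac{|x|^2}{4\xi}}u(t-\xi)\,d\xi\ (t\in[0,T]).$$ ($\mathcal W_0+\mathcal W_u$ is the solution of $W_t=\Delta W-2\delta u(t)$, $W(\cdot,0)=W^0$.)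 *)

theory Defs
  imports "HOL-Probability.Essential_Supremum"
begin

text \<open>Elements of Lebesgue spaces are represented by measurable functions, not by equivalence
  classes: \<^term>\<open>L2 M\<close> and \<^term>\<open>Linf M\<close> are closed under modification on null sets within the
  measurable functions, and so are the subspaces below.\<close>

definition L2 :: "'a measure \<Rightarrow> ('a \<Rightarrow> complex) set" where
  "L2 M = {f \<in> borel_measurable M. integrable M (\<lambda>x. (cmod (f x))\<^sup>2)}"

definition L2_norm :: "'a measure \<Rightarrow> ('a \<Rightarrow> complex) \<Rightarrow> real" where
  "L2_norm M f = sqrt (LINT x|M. (cmod (f x))\<^sup>2)"

definition Linf :: "'a measure \<Rightarrow> ('a \<Rightarrow> complex) set" where
  "Linf M = {f \<in> borel_measurable M. esssup M (\<lambda>x. ereal (cmod (f x))) < \<infinity>}"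

definition Linf_norm :: "'a measure \<Rightarrow> ('a \<Rightarrow> complex) \<Rightarrow> real" where
  "Linf_norm M f = real_of_ereal (esssup M (\<lambda>x. ereal (cmod (f x))))"

definition reflect1 :: "real^2 \<Rightarrow> real^2" where
  "reflect1 x = vector [- (x $ 1), x $ 2]"

definition H0_hat :: "(real^2 \<Rightarrow> complex) set" where
  "H0_hat = {f \<in> L2 lebesgue. AE x in lebesgue. f (reflect1 x) = f x}"

definition H_rad :: "(real^2 \<Rightarrow> complex) set" where
  "H_rad = {f \<in> L2 lebesgue.
     \<exists>g \<in> L2 (lebesgue_on {0<..}). AE x in lebesgue. f x = g ((norm x)\<^sup>2)}"

text \<open>\<open>Ck k\<close> are the \<open>k\<close> times continuously differentiable functions on the whole space;
  all directional derivatives are iterated, which amounts to iterating partial derivatives.\<close>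

primrec Ck :: "nat \<Rightarrow> ('a::real_normed_vector \<Rightarrow> 'b::real_normed_vector) set" where
  "Ck 0 = {f. continuous_on UNIV f}"
| "Ck (Suc k) = {f. (\<forall>x. f differentiable (at x)) \<and>
     (\<forall>v. (\<lambda>x. frechet_derivative f (at x) v) \<in> Ck k)}"

definition Cinf :: "('a::real_normed_vector \<Rightarrow> 'b::real_normed_vector) set" where
  "Cinf = (\<Inter>k. Ck k)"

definition convolution :: "(real^2 \<Rightarrow> complex) \<Rightarrow> (real^2 \<Rightarrow> complex) \<Rightarrow> real^2 \<Rightarrow> complex" where
  "convolution f g x = (LINT y|lebesgue. f (x - y) * g y)"

definition heat_kernel :: "real \<Rightarrow> real^2 \<Rightarrow> complex" where
  "heat_kernel t x = complex_of_real (1 / (4 * pi * t) * exp (- (norm x)\<^sup>2 / (4 * t)))"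

definition W_free :: "(real^2 \<Rightarrow> complex) \<Rightarrow> real \<Rightarrow> real^2 \<Rightarrow> complex" where
  "W_free W0 t = (if t = 0 then W0 else convolution (heat_kernel t) W0)"

text \<open>Only values of \<open>u\<close> on the open interval \<open>(0, t)\<close> enter. At \<open>x = 0\<close> the integral need not
  converge, in which case the Bochner integral is 0 by convention; this affects a null set only.\<close>

definition W_ctrl :: "(real \<Rightarrow> complex) \<Rightarrow> real \<Rightarrow> real^2 \<Rightarrow> complex" where
  "W_ctrl u t x = - complex_of_real (1 / pi) *
     (LINT \<xi>:{0<..<t}|lebesgue.
        complex_of_real (1 / (2 * \<xi>) * exp (- (norm x)\<^sup>2 / (4 * \<xi>))) * u (t - \<xi>))"

end

theory Submission
  imports Defs "HOL-Real_Asymp.Real_Asymp"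
begin

text \<open>Both norm bounds come from one application of Cauchy--Schwarz and Tonelli: split the kernel of an
  integral operator as a product, estimate one factor uniformly in the integration variable, and
  integrate the square of the other. For the heat kernel \<open>K\<close> the split is \<open>\<surd>K \<cdot> \<surd>K\<close>; for the control
  term it is \<open>\<xi>\<close> to the powers \<open>-1/4\<close> and \<open>-3/4\<close>, which gives the bound \<open>\<surd>(2t/\<pi>) \<parallel>u\<parallel>\<close>.

  Symmetry: convolution with the heat kernel commutes with every orthogonal map, so it preserves
  evenness and turns almost everywhere rotation invariance into pointwise rotation invariance. The
  image of Lebesgue measure under \<open>x \<mapsto> |x|\<^sup>2\<close> is \<open>\<pi>\<close> times Lebesgue measure on the half line, so square
  integrability of a radial function in the plane and of its profile are equivalent.

  Smoothness: polynomials times a fixed Gaussian are closed under directional derivatives, and by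
  dominated convergence the convolution with such a function is differentiable, with derivative
  the convolution with the derivative.\<close>

section \<open>Measure-preserving maps and radial integration in the plane\<close>

text \<open>Lebesgue measure is determined by its values on open boxes. The preimage of a box is its
  image under the inverse map, which is again orthogonal and therefore preserves volume.\<close>

lemma distr_lborel_orthogonal_transformation:
  fixes R :: "real^'n::{finite,wellorder} \<Rightarrow> real^'n::_"
  assumes R: "orthogonal_transformation R"
  shows "distr lborel borel R = lborel"
proof (rule lborel_eqI[symmetric])
  have lin: "linear R" by (rule orthogonal_transformation_linear[OF R])
  have [measurable]: "R \<in> borel_measurable borel"
    by (intro borel_measurable_continuous_onI linear_continuous_on linear_conv_bounded_linear[THEN iffD1] lin)
  have inv: "orthogonal_transformation (inv R)" by (rule orthogonal_transformation_inv[OF R])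
  fix l u :: "real^('n::{finite,wellorder})"
  assume le: "\<And>b. b \<in> Basis \<Longrightarrow> l \<bullet> b \<le> u \<bullet> b"
  have vim: "R -` box l u = inv R ` box l u"
    by (rule bij_vimage_eq_inv_image[OF orthogonal_transformation_bij[OF R]])
  have meas: "R -` box l u \<in> sets borel" using measurable_sets[of R borel borel "box l u"] by simp
  have "inv R ` box l u \<in> lmeasurable"
    by (intro measurable_linear_image orthogonal_transformation_linear[OF inv]) simp
  then have "emeasure lebesgue (inv R ` box l u) = ennreal (measure lebesgue (inv R ` box l u))"
    by (simp add: emeasure_eq_measure2)
  also have "\<dots> = ennreal (measure lebesgue (box l u))"
    by (subst measure_orthogonal_image[OF inv]) auto
  also have "\<dots> = emeasure lborel (box l u)"
    by (simp add: emeasure_eq_measure2)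
  finally have "emeasure lborel (R -` box l u) = emeasure lborel (box l u)"
    using meas by (simp add: vim)
  then show "emeasure (distr lborel borel R) (box l u) = (\<Prod>b\<in>Basis. (u - l) \<bullet> b)"
    using le by (simp add: emeasure_distr emeasure_lborel_box_eq)
qed simp

text \<open>Passage to the completion: preimages of null sets are null, so the map remains
  measurable for Lebesgue sets and preserves the completed measure.\<close>

lemma lebesgue_measure_preserving:
  fixes \<phi> :: "'a::euclidean_space \<Rightarrow> 'a"
  assumes [measurable]: "\<phi> \<in> borel_measurable borel" and eq: "distr lborel borel \<phi> = lborel"
  shows "\<phi> \<in> lebesgue \<rightarrow>\<^sub>M lebesgue" "distr lebesgue lebesgue \<phi> = lebesgue"
proof -
  have cm: "complete_measure (lebesgue :: 'a measure)" ..
  have d: "distr lebesgue lborel \<phi> = lborel"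
    using eq by (subst distr_completion) (auto cong: distr_cong)
  have m: "\<phi> \<in> lebesgue \<rightarrow>\<^sub>M lborel"
    by (intro measurable_completion) simp
  show "\<phi> \<in> lebesgue \<rightarrow>\<^sub>M lebesgue"
    by (rule complete_measure.measurable_completion2[OF cm m]) (simp add: d)
  show "distr lebesgue lebesgue \<phi> = lebesgue"
    using complete_measure.completion_distr_eq[OF cm m] by (simp add: d)
qed

text \<open>The sign makes the rays \<open>{c<..}\<close>, which determine a measure by \<open>measure_eqI_lessThan\<close>, have finite measure.\<close>

lemma distr_lborel_minus_norm_square:
  "distr lborel borel (\<lambda>x::real^2. - (norm x)\<^sup>2) = density lborel (\<lambda>r. ennreal pi * indicator {..<0} r)"
proof (rule measure_eqI_lessThan)
  have *: "emeasure (distr lborel borel (\<lambda>x::real^2. - (norm x)\<^sup>2)) {c<..} = ennreal (pi * max 0 (- c))" for c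
  proof -
    \<comment> \<open>The maximum covers c \<ge> 0, where the preimage is empty and so is the ball
      of radius 0.\<close>
    have "(\<lambda>x::real^2. - (norm x)\<^sup>2) -` {c<..} = ball 0 (sqrt (max 0 (- c)))"
    proof (intro set_eqI)
      fix x :: "real^2"
      have "norm x < sqrt (max 0 (- c)) \<longleftrightarrow> sqrt ((norm x)\<^sup>2) < sqrt (max 0 (- c))" by simp
      also have "\<dots> \<longleftrightarrow> c < - (norm x)\<^sup>2"
        unfolding real_sqrt_less_iff using zero_le_power2[of "norm x"] by (smt (verit))
      finally show "x \<in> (\<lambda>x. - (norm x)\<^sup>2) -` {c<..} \<longleftrightarrow> x \<in> ball 0 (sqrt (max 0 (- c)))" by simp
    qed
    then show ?thesis
      by (simp add: emeasure_distr emeasure_ball eval_unit_ball_vol)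
  qed
  show "emeasure (distr lborel borel (\<lambda>x::real^2. - (norm x)\<^sup>2)) {c<..} < \<infinity>" for c
    by (simp add: *)
  show "emeasure (distr lborel borel (\<lambda>x::real^2. - (norm x)\<^sup>2)) {c<..} =
    emeasure (density lborel (\<lambda>r. ennreal pi * indicator {..<0} r)) {c<..}" for c
  proof -
    have "emeasure (density lborel (\<lambda>r. ennreal pi * indicator {..<0} r)) {c<..}
      = ennreal pi * (\<integral>\<^sup>+r. indicator {c<..<0} r \<partial>lborel)"
      by (subst emeasure_density, simp, simp, subst nn_integral_cmult[symmetric])
        (auto intro!: nn_integral_cong split: split_indicator)
    also have "\<dots> = ennreal (pi * max 0 (- c))"
      by (simp add: ennreal_mult max_def)
    finally show ?thesis by (simp add: *)
  qed
qed simp_all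

text \<open>In dimension two the substitution r = |x|^2 has the constant density pi, because the
  area of a disc is linear in the square of its radius.\<close>

lemma nn_integral_radial:
  fixes g :: "real \<Rightarrow> ennreal"
  assumes [measurable]: "g \<in> borel_measurable borel"
  shows "(\<integral>\<^sup>+x. g ((norm x)\<^sup>2) \<partial>(lborel :: (real^2) measure)) = ennreal pi * (\<integral>\<^sup>+r. g r * indicator {0<..} r \<partial>lborel)"
proof -
  have "(\<integral>\<^sup>+x. g ((norm x)\<^sup>2) \<partial>(lborel :: (real^2) measure)) =
      (\<integral>\<^sup>+s. g (- s) \<partial>distr lborel borel (\<lambda>x::real^2. - (norm x)\<^sup>2))"
    by (subst nn_integral_distr) auto
  also have "\<dots> = (\<integral>\<^sup>+s. (ennreal pi * indicator {..<0} s) * g (- s) \<partial>lborel)"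
    by (simp add: distr_lborel_minus_norm_square nn_integral_density)
  also have "\<dots> = ennreal pi * (\<integral>\<^sup>+s. g (- s) * indicator {..<0} s \<partial>lborel)"
    by (simp add: nn_integral_cmult[symmetric] ac_simps)
  \<comment> \<open>Invariance of Lebesgue measure under s -> -s undoes the sign introduced for the
    pushforward.\<close>
  also have "(\<integral>\<^sup>+s. g (- s) * indicator {..<0} s \<partial>lborel) = (\<integral>\<^sup>+s. g (- s) * indicator {..<0} s \<partial>distr lborel borel uminus)"
    by (simp add: lborel_distr_uminus)
  also have "\<dots> = (\<integral>\<^sup>+r. g r * indicator {0<..} r \<partial>lborel)"
    by (subst nn_integral_distr) (auto intro!: nn_integral_cong split: split_indicator)
  finally show ?thesis .
qed

text \<open>In the variable r = |x|^2 the Gaussian becomes exp(-c r), which has an elementary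
  antiderivative.\<close>

lemma nn_integral_gaussian_plane:
  assumes c: "c > 0"
  shows "(\<integral>\<^sup>+x. ennreal (exp (- c * (norm x)\<^sup>2)) \<partial>(lborel :: (real^2) measure)) = ennreal (pi / c)"
proof -
  have "((\<lambda>r. - exp (- c * r) / c) \<longlongrightarrow> 0) at_top"
    using c by real_asymp
  then have "(\<integral>\<^sup>+r. ennreal (exp (- c * r)) * indicator {0..} r \<partial>lborel) = ennreal (0 - (- exp (- c * 0) / c))"
    using c by (intro nn_integral_FTC_atLeast) (auto intro!: derivative_eq_intros)
  also have "(\<integral>\<^sup>+r. ennreal (exp (- c * r)) * indicator {0..} r \<partial>lborel) =
    (\<integral>\<^sup>+r. ennreal (exp (- c * r)) * indicator {0<..} r \<partial>lborel)"
    by (intro nn_integral_cong_AE eventually_mono[OF AE_lborel_singleton[of 0]]) (auto split: split_indicator)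
  finally show ?thesis
    using c by (subst nn_integral_radial) (auto simp: ennreal_mult[symmetric])
qed

section \<open>Cauchy-Schwarz and square-integrability of integral operators\<close>

lemma Cauchy_Schwarz_nn_integral:
  fixes f g :: "'a \<Rightarrow> real"
  assumes [measurable]: "f \<in> borel_measurable M" "g \<in> borel_measurable M"
  shows "(\<integral>\<^sup>+x. ennreal \<bar>f x * g x\<bar> \<partial>M)\<^sup>2 \<le> (\<integral>\<^sup>+x. ennreal ((f x)\<^sup>2) \<partial>M) * (\<integral>\<^sup>+x. ennreal ((g x)\<^sup>2) \<partial>M)"
proof -
  \<comment> \<open>Since 0 * \<infinity> = 0 in \<open>ennreal\<close>, a vanishing factor makes
    the right-hand side 0 even if the other factor is infinite; the left-hand side then has to
    vanish too.\<close>
  have zero: "(\<integral>\<^sup>+x. ennreal \<bar>f x * g x\<bar> \<partial>M) = 0"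
    if "(\<integral>\<^sup>+x. ennreal ((f x)\<^sup>2) \<partial>M) = 0 \<or> (\<integral>\<^sup>+x. ennreal ((g x)\<^sup>2) \<partial>M) = 0"
    using that by (auto simp: nn_integral_0_iff_AE elim!: eventually_mono)
  consider "(\<integral>\<^sup>+x. ennreal ((f x)\<^sup>2) \<partial>M) = 0 \<or> (\<integral>\<^sup>+x. ennreal ((g x)\<^sup>2) \<partial>M) = 0"
    | "(\<integral>\<^sup>+x. ennreal ((f x)\<^sup>2) \<partial>M) \<noteq> 0" "(\<integral>\<^sup>+x. ennreal ((g x)\<^sup>2) \<partial>M) = \<infinity>"
    | "(\<integral>\<^sup>+x. ennreal ((g x)\<^sup>2) \<partial>M) \<noteq> 0" "(\<integral>\<^sup>+x. ennreal ((f x)\<^sup>2) \<partial>M) = \<infinity>"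
    | "(\<integral>\<^sup>+x. ennreal ((f x)\<^sup>2) \<partial>M) < \<infinity>" "(\<integral>\<^sup>+x. ennreal ((g x)\<^sup>2) \<partial>M) < \<infinity>"
        "(\<integral>\<^sup>+x. ennreal ((g x)\<^sup>2) \<partial>M) \<noteq> 0"
    unfolding infinity_ennreal_def less_top[symmetric] by blast
  then show ?thesis
  proof cases
    case 1 then show ?thesis by (simp add: zero)
  next
    case 2 then show ?thesis by (simp add: ennreal_mult_top)
  next
    case 3 then show ?thesis by (simp add: ennreal_top_mult)
  next
    case 4
    have f2: "integrable M (\<lambda>x. (f x)\<^sup>2)" and g2: "integrable M (\<lambda>x. (g x)\<^sup>2)"
      using 4 by (auto intro!: integrableI_bounded)
    have fg: "integrable M (\<lambda>x. \<bar>f x * g x\<bar>)"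
    proof (rule Bochner_Integration.integrable_bound[OF Bochner_Integration.integrable_add[OF f2 g2]])
      have "\<bar>f x\<bar> * \<bar>g x\<bar> \<le> (f x)\<^sup>2 + (g x)\<^sup>2" for x
      proof -
        have "2 * (\<bar>f x\<bar> * \<bar>g x\<bar>) \<le> (f x)\<^sup>2 + (g x)\<^sup>2"
          using sum_squares_bound[of "\<bar>f x\<bar>" "\<bar>g x\<bar>"] by simp
        moreover have "0 \<le> \<bar>f x\<bar> * \<bar>g x\<bar>" by simp
        ultimately show ?thesis by linarith
      qed
      then show "AE x in M. norm \<bar>f x * g x\<bar> \<le> norm ((f x)\<^sup>2 + (g x)\<^sup>2)"
        by (auto simp: abs_mult)
    qed simp
    define a b c where "a = (LINT x|M. (f x)\<^sup>2)" and "b = (LINT x|M. (g x)\<^sup>2)"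
      and "c = (LINT x|M. \<bar>f x * g x\<bar>)"
    \<comment> \<open>The integrand is the square of b times the residual of |f| after projection
      onto |g|, the projection coefficient being c / b. Scaling by b avoids the division.\<close>
    have "0 \<le> (LINT x|M. (b * \<bar>f x\<bar> - c * \<bar>g x\<bar>)\<^sup>2)" by simp
    also have "(\<lambda>x. (b * \<bar>f x\<bar> - c * \<bar>g x\<bar>)\<^sup>2) = (\<lambda>x. b\<^sup>2 * (f x)\<^sup>2 + c\<^sup>2 * (g x)\<^sup>2 - 2 * b * c * \<bar>f x * g x\<bar>)"
      by (auto simp: power2_diff power_mult_distrib abs_mult)
    also have "(LINT x|M. b\<^sup>2 * (f x)\<^sup>2 + c\<^sup>2 * (g x)\<^sup>2 - 2 * b * c * \<bar>f x * g x\<bar>) = b\<^sup>2 * a + c\<^sup>2 * b - 2 * b * c * c"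
      using f2 g2 fg by (simp add: a_def b_def c_def)
    also have "\<dots> = b * (a * b - c\<^sup>2)" by (simp add: algebra_simps power2_eq_square)
    finally have "0 \<le> b * (a * b - c\<^sup>2)" .
    moreover have eqs: "(\<integral>\<^sup>+x. ennreal ((f x)\<^sup>2) \<partial>M) = ennreal a" "(\<integral>\<^sup>+x. ennreal ((g x)\<^sup>2) \<partial>M) = ennreal b"
       "(\<integral>\<^sup>+x. ennreal \<bar>f x * g x\<bar> \<partial>M) = ennreal c"
      using f2 g2 fg by (auto simp: a_def b_def c_def nn_integral_eq_integral)
    moreover have "b > 0" using 4(3) eqs(2) by (auto simp: ennreal_eq_0_iff not_le)
    moreover have "a \<ge> 0" "c \<ge> 0" by (auto simp: a_def c_def)
    ultimately show ?thesis
      by (auto simp: ennreal_mult[symmetric] ennreal_power zero_le_mult_iff)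
  qed
qed

text \<open>A form of Schur's test. Joint measurability is required of \<open>g\<close>, since
  Tonelli exchanges its two integrations; \<open>f\<close> enters for one fixed \<open>x\<close> at
  a time.\<close>

lemma nn_integral_square_kernel_le:
  fixes h :: "'a \<Rightarrow> 'b \<Rightarrow> 'c::{banach,second_countable_topology}" and f g :: "'a \<Rightarrow> 'b \<Rightarrow> real"
  assumes "sigma_finite_measure M" "sigma_finite_measure N"
    and f[measurable]: "\<And>x. f x \<in> borel_measurable N"
    and g[measurable]: "case_prod g \<in> borel_measurable (M \<Otimes>\<^sub>M N)"
    and le: "\<And>x s. x \<in> space M \<Longrightarrow> s \<in> space N \<Longrightarrow> norm (h x s) \<le> \<bar>f x s * g x s\<bar>"
    and A: "\<And>x. x \<in> space M \<Longrightarrow> (\<integral>\<^sup>+s. ennreal ((f x s)\<^sup>2) \<partial>N) \<le> A"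
    and B: "\<And>s. s \<in> space N \<Longrightarrow> (\<integral>\<^sup>+x. ennreal ((g x s)\<^sup>2) \<partial>M) \<le> B s"
  shows "(\<integral>\<^sup>+x. ennreal ((norm (LINT s|N. h x s))\<^sup>2) \<partial>M) \<le> A * (\<integral>\<^sup>+s. B s \<partial>N)"
proof -
  interpret pair_sigma_finite M N
    using assms(1,2) by (simp add: pair_sigma_finite_def)
  have pt: "ennreal ((norm (LINT s|N. h x s))\<^sup>2) \<le> A * (\<integral>\<^sup>+s. ennreal ((g x s)\<^sup>2) \<partial>N)" if x: "x \<in> space M" for x
  proof -
    have "ennreal (norm (LINT s|N. h x s)) \<le> (\<integral>\<^sup>+s. ennreal (norm (h x s)) \<partial>N)"
    \<comment> \<open>Where \<open>h x\<close> fails to be integrable, the Bochner integral is 0 by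
      convention and the bound is trivial. This covers the origin in the control term.\<close>
    proof (cases "integrable N (h x)")
      case True then show ?thesis by (rule integral_norm_bound_ennreal)
    qed (simp add: not_integrable_integral_eq)
    also have "\<dots> \<le> (\<integral>\<^sup>+s. ennreal \<bar>f x s * g x s\<bar> \<partial>N)"
      by (intro nn_integral_mono ennreal_leI le x)
    finally have "(ennreal (norm (LINT s|N. h x s)))\<^sup>2 \<le> (\<integral>\<^sup>+s. ennreal \<bar>f x s * g x s\<bar> \<partial>N)\<^sup>2"
      by (rule power_mono) simp
    also have "\<dots> \<le> (\<integral>\<^sup>+s. ennreal ((f x s)\<^sup>2) \<partial>N) * (\<integral>\<^sup>+s. ennreal ((g x s)\<^sup>2) \<partial>N)"
      by (rule Cauchy_Schwarz_nn_integral) (use x in measurable)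
    also have "\<dots> \<le> A * (\<integral>\<^sup>+s. ennreal ((g x s)\<^sup>2) \<partial>N)"
      by (intro mult_right_mono A x) simp
    finally show ?thesis by (simp add: ennreal_power)
  qed
  have "(\<integral>\<^sup>+x. ennreal ((norm (LINT s|N. h x s))\<^sup>2) \<partial>M) \<le> (\<integral>\<^sup>+x. A * (\<integral>\<^sup>+s. ennreal ((g x s)\<^sup>2) \<partial>N) \<partial>M)"
    by (intro nn_integral_mono pt)
  also have "\<dots> = A * (\<integral>\<^sup>+x. (\<integral>\<^sup>+s. ennreal ((g x s)\<^sup>2) \<partial>N) \<partial>M)"
    by (rule nn_integral_cmult) measurable
  also have "(\<integral>\<^sup>+x. (\<integral>\<^sup>+s. ennreal ((g x s)\<^sup>2) \<partial>N) \<partial>M) = (\<integral>\<^sup>+s. (\<integral>\<^sup>+x. ennreal ((g x s)\<^sup>2) \<partial>M) \<partial>N)"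
    by (rule Fubini'[symmetric]) measurable
  also have "A * \<dots> \<le> A * (\<integral>\<^sup>+s. B s \<partial>N)"
    by (intro mult_left_mono nn_integral_mono B) auto
  finally show ?thesis .
qed

lemma L2I:
  assumes [measurable]: "f \<in> borel_measurable borel"
    and le: "(\<integral>\<^sup>+x. ennreal ((cmod (f x))\<^sup>2) \<partial>lborel) \<le> ennreal C" and C: "C \<ge> 0"
  shows "f \<in> L2 lebesgue" "L2_norm lebesgue f \<le> sqrt C"
proof -
  have int: "integrable lborel (\<lambda>x. (cmod (f x))\<^sup>2)"
    using le by (intro integrableI_bounded) (auto intro: le_less_trans)
  then show "f \<in> L2 lebesgue"
    by (auto simp: L2_def integrable_completion intro: measurable_completion)
  have "(LINT x|lborel. (cmod (f x))\<^sup>2) \<le> C"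
    using le C int by (simp add: nn_integral_eq_integral)
  then show "L2_norm lebesgue f \<le> sqrt C"
    by (simp add: L2_norm_def integral_completion)
qed

text \<open>The profile \<open>G\<close> itself is the witness: \<open>nn_integral_radial\<close>
  turns the finite integral over the plane into one over the half line.\<close>

lemma H_radI:
  fixes G :: "real \<Rightarrow> complex"
  assumes [measurable]: "G \<in> borel_measurable borel"
    and L2: "(\<lambda>x::real^2. G ((norm x)\<^sup>2)) \<in> L2 lebesgue"
  shows "(\<lambda>x. G ((norm x)\<^sup>2)) \<in> H_rad"
proof -
  have "integrable lborel (\<lambda>x::real^2. (cmod (G ((norm x)\<^sup>2)))\<^sup>2)"
    using L2 by (simp add: L2_def integrable_completion)
  then have "(\<integral>\<^sup>+x. ennreal ((cmod (G ((norm x)\<^sup>2)))\<^sup>2) \<partial>(lborel :: (real^2) measure)) < \<infinity>"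
    by (simp add: integrable_iff_bounded)
  then have "(\<integral>\<^sup>+r. ennreal ((cmod (G r))\<^sup>2) * indicator {0<..} r \<partial>lborel) < \<infinity>"
    by (subst (asm) nn_integral_radial) (auto simp: ennreal_mult_less_top)
  then have "integrable (lebesgue_on {0<..}) (\<lambda>r. (cmod (G r))\<^sup>2)"
    by (intro integrableI_bounded)
      (auto simp: nn_integral_restrict_space nn_integral_completion
        intro!: measurable_restrict_space1 measurable_completion)
  then have "G \<in> L2 (lebesgue_on {0<..})"
    by (auto simp: L2_def intro!: measurable_restrict_space1 measurable_completion)
  then show ?thesis using L2 by (auto simp: H_rad_def)
qed

section \<open>Convolution with the heat kernel\<close>

lemma distr_lborel_reflect_affine:
  "distr lborel borel (\<lambda>y. x - y) = (lborel :: 'a::euclidean_space measure)"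
  using lborel_affine[of "-1" x] by (simp add: density_1)

lemma distr_lborel_translation:
  "distr lborel borel (\<lambda>y. y - x) = (lborel :: 'a::euclidean_space measure)"
  using lborel_affine[of "1" "- x"] by (simp add: density_1)

text \<open>Real-valued form of \<open>heat_kernel\<close>, so that positivity, square roots and
  scalar multiplication are available.\<close>

definition heat_kernel_real :: "real \<Rightarrow> real^2 \<Rightarrow> real" where
  "heat_kernel_real t x = 1 / (4 * pi * t) * exp (- (norm x)\<^sup>2 / (4 * t))"

lemma heat_kernel_real_measurable [measurable]: "heat_kernel_real t \<in> borel_measurable borel"
  unfolding heat_kernel_real_def by measurable

lemma heat_kernel_real_nonneg: "t \<ge> 0 \<Longrightarrow> heat_kernel_real t x \<ge> 0"
  by (simp add: heat_kernel_real_def)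

lemma nn_integral_heat_kernel_real:
  assumes "t > 0"
  shows "(\<integral>\<^sup>+x. ennreal (heat_kernel_real t x) \<partial>lborel) = 1"
proof -
  have "(\<integral>\<^sup>+x. ennreal (heat_kernel_real t x) \<partial>lborel) =
      (\<integral>\<^sup>+x. ennreal (1 / (4 * pi * t)) * ennreal (exp (- (1 / (4 * t)) * (norm (x::real^2))\<^sup>2)) \<partial>lborel)"
    using assms by (intro nn_integral_cong) (simp add: heat_kernel_real_def ennreal_mult[symmetric])
  also have "\<dots> = ennreal (1 / (4 * pi * t)) * ennreal (pi / (1 / (4 * t)))"
    using assms by (subst nn_integral_cmult, simp, subst nn_integral_gaussian_plane) simp_all
  also have "\<dots> = 1"
    using assms by (simp add: ennreal_mult[symmetric])
  finally show ?thesis .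
qed

lemma sigma_finite_lebesgue: "sigma_finite_measure (lebesgue :: 'a::euclidean_space measure)"
proof -
  obtain A :: "nat \<Rightarrow> 'a set" where "range A \<subseteq> sets lborel" "(\<Union>i. A i) = space lborel" "\<And>i. emeasure lborel (A i) \<noteq> \<infinity>"
    using lborel.sigma_finite by blast
  then show ?thesis
    by (intro sigma_finite_measure.intro exI[of _ "range A"]) auto
qed

lemma convolution_heat_kernel:
  "convolution (heat_kernel t) W x = (LINT y|lebesgue. heat_kernel_real t (x - y) *\<^sub>R W y)"
  by (simp add: convolution_def heat_kernel_def heat_kernel_real_def scaleR_conv_of_real)

text \<open>The variable \<open>x\<close> enters through the Borel kernel alone, so the result is
  Borel measurable although \<open>W\<close> is merely Lebesgue measurable.\<close>

lemma convolution_heat_kernel_measurable: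
  assumes [measurable]: "W \<in> borel_measurable lebesgue"
  shows "convolution (heat_kernel t) W \<in> borel_measurable borel"
proof -
  have [measurable]: "(\<lambda>y. y) \<in> lebesgue \<rightarrow>\<^sub>M (borel :: (real^2) measure)"
    by (rule measurable_completion) simp
  interpret sigma_finite_measure "lebesgue :: (real^2) measure" by (rule sigma_finite_lebesgue)
  have [measurable]: "(\<lambda>z::(real^2)\<times>(real^2). fst z - snd z) \<in> borel \<Otimes>\<^sub>M lebesgue \<rightarrow>\<^sub>M borel"
    by measurable
  show ?thesis
    unfolding convolution_heat_kernel by measurable
qed

lemma nn_integral_convolution_heat_kernel_le:
  assumes t: "t > 0" and [measurable]: "W \<in> borel_measurable lebesgue"
  shows "(\<integral>\<^sup>+x. ennreal ((cmod (convolution (heat_kernel t) W x))\<^sup>2) \<partial>lborel) \<le> (\<integral>\<^sup>+y. ennreal ((cmod (W y))\<^sup>2) \<partial>lebesgue)"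
proof -
  let ?k = "heat_kernel_real t"
  note nn = heat_kernel_real_nonneg[OF less_imp_le[OF t]]
  have [measurable]: "(\<lambda>y. y) \<in> lebesgue \<rightarrow>\<^sub>M (borel :: (real^2) measure)"
    by (rule measurable_completion) simp
  have "(\<integral>\<^sup>+x. ennreal ((cmod (LINT y|lebesgue. ?k (x - y) *\<^sub>R W y))\<^sup>2) \<partial>lborel) \<le> 1 * (\<integral>\<^sup>+y. ennreal ((cmod (W y))\<^sup>2) \<partial>lebesgue)"
  \<comment> \<open>Both estimates use that the kernel has mass 1: integrating in \<open>y\<close>
    gives the constant 1, integrating in \<open>x\<close> leaves |W y|^2. Hence the convolution is a
    contraction of L2.\<close>
  proof (rule nn_integral_square_kernel_le[where f="\<lambda>x y. sqrt (?k (x - y))" and g="\<lambda>x y. sqrt (?k (x - y)) * cmod (W y)"])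
    show "sigma_finite_measure (lebesgue :: (real^2) measure)" by (rule sigma_finite_lebesgue)
    show "sigma_finite_measure (lborel :: (real^2) measure)" by (rule sigma_finite_lborel)
    show "norm (?k (x - y) *\<^sub>R W y) \<le> \<bar>sqrt (?k (x - y)) * (sqrt (?k (x - y)) * cmod (W y))\<bar>" for x y
      using nn[of "x - y"] by (simp add: abs_mult mult.assoc[symmetric])
    show "(\<integral>\<^sup>+y. ennreal ((sqrt (?k (x - y)))\<^sup>2) \<partial>lebesgue) \<le> 1" for x
    proof -
      have "(\<integral>\<^sup>+y. ennreal ((sqrt (?k (x - y)))\<^sup>2) \<partial>lebesgue) = (\<integral>\<^sup>+y. ennreal (?k (x - y)) \<partial>lborel)"
        by (simp add: nn_integral_completion nn)
      also have "\<dots> = (\<integral>\<^sup>+y. ennreal (?k y) \<partial>distr lborel borel (\<lambda>y. x - y))"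
        by (subst nn_integral_distr) auto
      finally show ?thesis
        by (simp add: distr_lborel_reflect_affine nn_integral_heat_kernel_real t)
    qed
    show "(\<integral>\<^sup>+x. ennreal ((sqrt (?k (x - y)) * cmod (W y))\<^sup>2) \<partial>lborel) \<le> ennreal ((cmod (W y))\<^sup>2)" for y
    proof -
      have "(\<integral>\<^sup>+x. ennreal ((sqrt (?k (x - y)) * cmod (W y))\<^sup>2) \<partial>lborel) = (\<integral>\<^sup>+x. ennreal (?k (x - y)) * ennreal ((cmod (W y))\<^sup>2) \<partial>lborel)"
        by (simp add: power_mult_distrib nn ennreal_mult)
      also have "\<dots> = (\<integral>\<^sup>+x. ennreal (?k (x - y)) \<partial>lborel) * ennreal ((cmod (W y))\<^sup>2)"
        by (rule nn_integral_multc) simp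
      also have "(\<integral>\<^sup>+x. ennreal (?k (x - y)) \<partial>lborel) = (\<integral>\<^sup>+x. ennreal (?k x) \<partial>distr lborel borel (\<lambda>x. x - y))"
        by (subst nn_integral_distr) auto
      finally show ?thesis
        by (simp add: distr_lborel_translation nn_integral_heat_kernel_real t)
    qed
  qed measurable
  then show ?thesis by (simp add: convolution_heat_kernel)
qed

lemma convolution_heat_kernel_L2:
  assumes "t > 0" and W: "W \<in> L2 lebesgue"
  shows "convolution (heat_kernel t) W \<in> L2 lebesgue"
proof -
  have m: "W \<in> borel_measurable lebesgue" and int: "integrable lebesgue (\<lambda>x. (cmod (W x))\<^sup>2)"
    using W by (auto simp: L2_def)
  show ?thesis
    using nn_integral_convolution_heat_kernel_le[OF assms(1) m] int
    by (intro L2I(1)[OF convolution_heat_kernel_measurable[OF m], where C="LINT x|lebesgue. (cmod (W x))\<^sup>2"])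
      (simp_all add: nn_integral_eq_integral)
qed

section \<open>Symmetries of the free evolution\<close>

lemma orthogonal_transformation_lebesgue:
  fixes R :: "real^'n::{finite,wellorder} \<Rightarrow> real^'n::_"
  assumes R: "orthogonal_transformation R"
  shows "R \<in> lebesgue \<rightarrow>\<^sub>M lebesgue" "distr lebesgue lebesgue R = lebesgue"
proof -
  have "R \<in> borel_measurable borel"
    by (intro borel_measurable_continuous_onI linear_continuous_on
      linear_conv_bounded_linear[THEN iffD1] orthogonal_transformation_linear R)
  from lebesgue_measure_preserving[OF this distr_lborel_orthogonal_transformation[OF R]]
  show "R \<in> lebesgue \<rightarrow>\<^sub>M lebesgue" "distr lebesgue lebesgue R = lebesgue" by auto
qed

text \<open>Substitute \<open>R y\<close> for \<open>y\<close> and use |R x - R y| = |x - y|. The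
  almost everywhere hypothesis is used under the integral only, so the conclusion holds at every
  \<open>x\<close>.\<close>

lemma convolution_heat_kernel_orthogonal:
  assumes R: "orthogonal_transformation R" and W[measurable]: "W \<in> borel_measurable lebesgue"
    and inv: "AE y in lebesgue. W (R y) = W y"
  shows "convolution (heat_kernel t) W (R x) = convolution (heat_kernel t) W x"
proof -
  note [measurable] = orthogonal_transformation_lebesgue(1)[OF R]
  have [measurable]: "(\<lambda>y. y) \<in> lebesgue \<rightarrow>\<^sub>M (borel :: (real^2) measure)"
    by (rule measurable_completion) simp
  have k: "heat_kernel_real t (R x - R y) = heat_kernel_real t (x - y)" for y
    using R by (simp add: heat_kernel_real_def orthogonal_transformation linear_diff[symmetric])
  have "convolution (heat_kernel t) W (R x) =
      (LINT y|distr lebesgue lebesgue R. heat_kernel_real t (R x - y) *\<^sub>R W y)"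
    by (simp add: convolution_heat_kernel orthogonal_transformation_lebesgue(2)[OF R])
  also have "\<dots> = (LINT y|lebesgue. heat_kernel_real t (x - y) *\<^sub>R W (R y))"
    by (subst integral_distr) (auto simp: k)
  also have "\<dots> = (LINT y|lebesgue. heat_kernel_real t (x - y) *\<^sub>R W y)"
    by (rule integral_cong_AE) (use inv in auto)
  finally show ?thesis by (simp add: convolution_heat_kernel)
qed

lemma orthogonal_transformation_reflect1: "orthogonal_transformation reflect1"
  unfolding orthogonal_transformation_def
  by (auto simp: reflect1_def vec_eq_iff forall_2 inner_vec_def sum_2 intro!: linearI)

lemma W_free_H0_hat:
  assumes W: "W \<in> H0_hat" and t: "t \<ge> 0"
  shows "W_free W t \<in> H0_hat"
proof (cases "t = 0")
  case False
  have "W \<in> L2 lebesgue" "AE x in lebesgue. W (reflect1 x) = W x"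
    using W by (auto simp: H0_hat_def)
  moreover from this have "W \<in> borel_measurable lebesgue" by (simp add: L2_def)
  ultimately show ?thesis
    using False t
    by (simp add: W_free_def H0_hat_def convolution_heat_kernel_L2
        convolution_heat_kernel_orthogonal[OF orthogonal_transformation_reflect1])
qed (use W in \<open>simp add: W_free_def\<close>)

lemma W_free_H_rad:
  assumes W: "W \<in> H_rad" and t: "t \<ge> 0"
  shows "W_free W t \<in> H_rad"
proof (cases "t = 0")
  case False
  let ?F = "convolution (heat_kernel t) W" and ?e = "axis 1 1 :: real^2"
  obtain g where L2: "W \<in> L2 lebesgue" and g: "AE x in lebesgue. W x = g ((norm x)\<^sup>2)"
    using W by (auto simp: H_rad_def)
  have m: "W \<in> borel_measurable lebesgue" using L2 by (simp add: L2_def)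
  note [measurable] = convolution_heat_kernel_measurable[OF m]
  \<comment> \<open>The profile is r -> \<open>?F\<close> at sqrt r times the first unit vector. The
    square root of the squared norm is left unsimplified to match the shape required by
    \<open>H_radI\<close>.\<close>
  have F: "?F = (\<lambda>x. ?F (sqrt ((norm x)\<^sup>2) *\<^sub>R ?e))"
  proof
    fix x :: "real^2"
    obtain R where R: "orthogonal_transformation R" and Rx: "R x = sqrt ((norm x)\<^sup>2) *\<^sub>R ?e"
      by (rule orthogonal_transformation_exists[of x "sqrt ((norm x)\<^sup>2) *\<^sub>R ?e"]) auto
    \<comment> \<open>\<open>R\<close> depends on the point \<open>x\<close> being treated, and so
      may the exceptional null set; this is harmless because invariance under this one
      \<open>R\<close> gives equality at that point.\<close>
    have "AE x in distr lebesgue lebesgue R. W x = g ((norm x)\<^sup>2)"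
      using g unfolding orthogonal_transformation_lebesgue(2)[OF R] .
    then have "AE x in lebesgue. W (R x) = g ((norm (R x))\<^sup>2)"
      by (rule AE_distrD[OF orthogonal_transformation_lebesgue(1)[OF R]])
    with g have "AE x in lebesgue. W (R x) = W x"
      by eventually_elim (use R in \<open>simp add: orthogonal_transformation\<close>)
    from convolution_heat_kernel_orthogonal[OF R m this, of t x] show "?F x = ?F (sqrt ((norm x)\<^sup>2) *\<^sub>R ?e)"
      by (simp add: Rx)
  qed
  have "?F \<in> L2 lebesgue"
    using convolution_heat_kernel_L2[OF _ L2] False t by simp
  \<comment> \<open>The equation \<open>F\<close> has \<open>?F\<close> on both sides, so it is
    applied exactly once, at an explicit predicate, instead of as a rewrite rule.\<close>
  then have "(\<lambda>x::real^2. ?F (sqrt ((norm x)\<^sup>2) *\<^sub>R ?e)) \<in> L2 lebesgue"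
    by (rule subst[OF F, where P="\<lambda>f. f \<in> L2 lebesgue"])
  then have "(\<lambda>x::real^2. ?F (sqrt ((norm x)\<^sup>2) *\<^sub>R ?e)) \<in> H_rad"
    by (rule H_radI[rotated]) measurable
  then have "?F \<in> H_rad" by (rule ssubst[OF F, where P="\<lambda>f. f \<in> H_rad"])
  then show ?thesis using False by (simp add: W_free_def)
qed (use W in \<open>simp add: W_free_def\<close>)

section \<open>Essential bounds and the control term\<close>

lemma Linf_AE_bound:
  assumes "u \<in> Linf M"
  shows "AE x in M. cmod (u x) \<le> Linf_norm M u"
proof -
  let ?e = "esssup M (\<lambda>x. ereal (cmod (u x)))"
  have "?e < \<infinity>" using assms by (simp add: Linf_def)
  moreover have "AE x in M. ereal (cmod (u x)) \<le> ?e" by (rule esssup_AE)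
  ultimately show ?thesis
    \<comment> \<open>If the essential supremum is -\<infinity>, the almost everywhere inequality is
      contradictory at each point and the claim holds vacuously.\<close>
    unfolding Linf_norm_def by (cases ?e) (auto elim!: eventually_mono)
qed

text \<open>On a space of nonzero measure the essential bound holds at some point, and there it
  dominates a modulus.\<close>

lemma Linf_norm_nonneg:
  assumes "u \<in> Linf M" and "emeasure M (space M) \<noteq> 0"
  shows "Linf_norm M u \<ge> 0"
proof -
  have "ae_filter M \<noteq> bot" using assms(2) by (simp add: ae_filter_eq_bot_iff)
  from eventually_happens'[OF this Linf_AE_bound[OF assms(1)]]
  show ?thesis using norm_ge_zero order_trans by blast
qed

lemma nn_integral_inverse_sqrt:
  assumes "t \<ge> 0"
  shows "(\<integral>\<^sup>+\<xi>. ennreal (\<xi> powr (- 1 / 2)) \<partial>lebesgue_on {0<..<t}) = ennreal (2 * sqrt t)"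
proof -
  have "((\<lambda>x. x powr (- 1 / 2)) has_integral (t powr (- 1 / 2 + 1) / (- 1 / 2 + 1))) {0..t}"
    by (rule has_integral_powr_from_0) (use assms in auto)
  then have "(\<integral>\<^sup>+\<xi>. indicator {0..t} \<xi> * ennreal (\<xi> powr (- 1 / 2)) \<partial>lborel) = ennreal (2 * sqrt t)"
    using assms nn_integral_has_integral_lebesgue[of "{0..t}" "\<lambda>x. x powr (- 1 / 2)"]
    by (simp add: powr_half_sqrt mult.commute nn_integral_completion ennreal_mult ennreal_indicator)
  moreover have "(\<integral>\<^sup>+\<xi>. ennreal (\<xi> powr (- 1 / 2)) \<partial>lebesgue_on {0<..<t}) =
      (\<integral>\<^sup>+\<xi>. indicator {0..t} \<xi> * ennreal (\<xi> powr (- 1 / 2)) \<partial>lborel)"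
    \<comment> \<open>The open and the closed interval differ by the two endpoints, a null
      set.\<close>
    unfolding nn_integral_restrict_space[of "{0<..<t}" lebesgue, simplified] nn_integral_completion
    by (intro nn_integral_cong_AE eventually_mono[OF eventually_conj[OF AE_lborel_singleton[of 0] AE_lborel_singleton[of t]]])
      (auto split: split_indicator)
  ultimately show ?thesis by simp
qed

context
  fixes T t :: real and u :: "real \<Rightarrow> complex"
  assumes t: "0 \<le> t" "t \<le> T" and u: "u \<in> Linf (lebesgue_on {0<..<T})"
begin

text \<open>The reflection s -> t - s preserves Lebesgue measure and maps (0,t) into (0,T) because t
  \<le> T, so measurability and the essential bound of \<open>u\<close> carry over.\<close>

lemma time_reversal:
  shows "(\<lambda>\<xi>. u (t - \<xi>)) \<in> borel_measurable (lebesgue_on {0<..<t})"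
    and "AE \<xi> in lebesgue_on {0<..<t}. cmod (u (t - \<xi>)) \<le> Linf_norm (lebesgue_on {0<..<T}) u"
proof -
  have mp: "(\<lambda>\<xi>. t - \<xi>) \<in> lebesgue \<rightarrow>\<^sub>M lebesgue" "distr lebesgue lebesgue (\<lambda>\<xi>. t - \<xi>) = lebesgue"
    by (rule lebesgue_measure_preserving[OF _ distr_lborel_reflect_affine]; simp)+
  have "(\<lambda>\<xi>. t - \<xi>) \<in> lebesgue_on {0<..<t} \<rightarrow>\<^sub>M lebesgue_on {0<..<T}"
    by (rule measurable_restrict_space3[OF mp(1)]) (use t in auto)
  moreover have "u \<in> borel_measurable (lebesgue_on {0<..<T})"
    using u by (simp add: Linf_def)
  ultimately show "(\<lambda>\<xi>. u (t - \<xi>)) \<in> borel_measurable (lebesgue_on {0<..<t})"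
    by (rule measurable_compose)
  have "AE s in distr lebesgue lebesgue (\<lambda>\<xi>. t - \<xi>). s \<in> {0<..<T} \<longrightarrow> cmod (u s) \<le> Linf_norm (lebesgue_on {0<..<T}) u"
    using Linf_AE_bound[OF u] unfolding mp(2) by (simp add: AE_restrict_space_iff)
  from AE_distrD[OF mp(1) this]
  show "AE \<xi> in lebesgue_on {0<..<t}. cmod (u (t - \<xi>)) \<le> Linf_norm (lebesgue_on {0<..<T}) u"
    using t by (auto simp: AE_restrict_space_iff elim!: eventually_mono)
qed

text \<open>The integrand of \<open>W_ctrl\<close> in the variable r = |x|^2, with the prefactor
  moved inside; this exhibits the radial profile.\<close>

definition ctrl_kernel :: "real \<Rightarrow> real \<Rightarrow> complex" where
  "ctrl_kernel r \<xi> = - complex_of_real (1 / pi) *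
     (complex_of_real (1 / (2 * \<xi>) * exp (- r / (4 * \<xi>))) * u (t - \<xi>))"

lemma W_ctrl_eq: "W_ctrl u t x = (LINT \<xi>|lebesgue_on {0<..<t}. ctrl_kernel ((norm x)\<^sup>2) \<xi>)"
  unfolding W_ctrl_def ctrl_kernel_def
  by (subst integral_mult_right_zero) (simp add: set_lebesgue_integral_def integral_restrict_space)

lemma ctrl_measurable: "(\<lambda>r. LINT \<xi>|lebesgue_on {0<..<t}. ctrl_kernel r \<xi>) \<in> borel_measurable borel"
proof -
  note [measurable] = time_reversal(1)
  have [measurable]: "(\<lambda>\<xi>. \<xi>) \<in> lebesgue_on {0<..<t} \<rightarrow>\<^sub>M (borel :: real measure)"
    by (intro measurable_restrict_space1 measurable_completion) simp
  interpret sigma_finite_measure "lebesgue_on {0<..<t}"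
    by (rule sigma_finite_measure_restrict_space[OF sigma_finite_lebesgue]) simp
  show ?thesis unfolding ctrl_kernel_def by measurable
qed

text \<open>The powers -1/4 and -3/4 balance the two estimates. The square of the first is
  \<xi>^(-1/2); the square of the second is \<xi>^(-3/2), and the planar Gaussian integral 2 pi
  \<xi> raises it to \<xi>^(-1/2) as well. Both are integrable at 0.\<close>

lemma nn_integral_W_ctrl_le:
  "(\<integral>\<^sup>+x. ennreal ((cmod (W_ctrl u t x))\<^sup>2) \<partial>lborel) \<le> ennreal (2 * t / pi * (Linf_norm (lebesgue_on {0<..<T}) u)\<^sup>2)"
proof -
  let ?N = "lebesgue_on {0<..<t}" and ?K = "Linf_norm (lebesgue_on {0<..<T}) u"
  note [measurable] = time_reversal(1)
  have [measurable]: "(\<lambda>\<xi>. \<xi>) \<in> lebesgue_on {0<..<t} \<rightarrow>\<^sub>M (borel :: real measure)"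
    by (intro measurable_restrict_space1 measurable_completion) simp
  have "(\<integral>\<^sup>+x. ennreal ((cmod (LINT \<xi>|?N. ctrl_kernel ((norm x)\<^sup>2) \<xi>))\<^sup>2) \<partial>(lborel :: (real^2) measure))
    \<le> ennreal (2 * sqrt t) * (\<integral>\<^sup>+\<xi>. ennreal (\<xi> powr (- 1 / 2) / (2 * pi) * (cmod (u (t - \<xi>)))\<^sup>2) \<partial>?N)"
  proof (rule nn_integral_square_kernel_le[where f="\<lambda>x \<xi>. \<xi> powr (- 1 / 4)"
        and g="\<lambda>x \<xi>. \<xi> powr (- 3 / 4) / (2 * pi) * cmod (u (t - \<xi>)) * exp (- (norm x)\<^sup>2 / (4 * \<xi>))"])
    show "sigma_finite_measure ?N"
      by (rule sigma_finite_measure_restrict_space[OF sigma_finite_lebesgue]) simp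
    show "sigma_finite_measure (lborel :: (real^2) measure)" by (rule sigma_finite_lborel)
    fix \<xi> assume "\<xi> \<in> space ?N"
    then have \<xi>: "\<xi> > 0" by auto
    show "norm (ctrl_kernel ((norm x)\<^sup>2) \<xi>) \<le> \<bar>\<xi> powr (- 1 / 4) *
       (\<xi> powr (- 3 / 4) / (2 * pi) * cmod (u (t - \<xi>)) * exp (- (norm x)\<^sup>2 / (4 * \<xi>)))\<bar>" for x :: "real^2"
    proof -
      have "\<xi> powr (- 1 / 4) * \<xi> powr (- 3 / 4) = 1 / \<xi>"
        using \<xi> by (simp add: powr_add[symmetric] powr_minus_divide)
      then have "\<xi> powr (- 1 / 4) * (\<xi> powr (- 3 / 4) / (2 * pi) * cmod (u (t - \<xi>)) * exp (- (norm x)\<^sup>2 / (4 * \<xi>)))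
        = 1 / \<xi> / (2 * pi) * cmod (u (t - \<xi>)) * exp (- (norm x)\<^sup>2 / (4 * \<xi>))"
        by (metis (no_types, opaque_lifting) mult.assoc times_divide_eq_right)
      moreover have "norm (ctrl_kernel ((norm x)\<^sup>2) \<xi>) = 1 / \<xi> / (2 * pi) * cmod (u (t - \<xi>)) * exp (- (norm x)\<^sup>2 / (4 * \<xi>))"
        using \<xi> by (simp add: ctrl_kernel_def norm_mult norm_divide field_simps)
      ultimately show ?thesis by (metis abs_ge_self)
    qed
    show "(\<integral>\<^sup>+x. ennreal ((\<xi> powr (- 3 / 4) / (2 * pi) * cmod (u (t - \<xi>)) * exp (- (norm x)\<^sup>2 / (4 * \<xi>)))\<^sup>2) \<partial>(lborel :: (real^2) measure))
        \<le> ennreal (\<xi> powr (- 1 / 2) / (2 * pi) * (cmod (u (t - \<xi>)))\<^sup>2)"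
    proof -
      let ?c = "(\<xi> powr (- 3 / 4) / (2 * pi) * cmod (u (t - \<xi>)))\<^sup>2"
      have "(\<integral>\<^sup>+x. ennreal ((\<xi> powr (- 3 / 4) / (2 * pi) * cmod (u (t - \<xi>)) * exp (- (norm x)\<^sup>2 / (4 * \<xi>)))\<^sup>2) \<partial>(lborel :: (real^2) measure))
        = (\<integral>\<^sup>+x. ennreal ?c * ennreal (exp (- (1 / (2 * \<xi>)) * (norm x)\<^sup>2)) \<partial>(lborel :: (real^2) measure))"
      proof (intro nn_integral_cong)
        fix x :: "real^2"
        \<comment> \<open>Squaring doubles the rate to 1/(2 \<xi>), whose Gaussian integral is 2 pi
          \<xi>.\<close>
        have "(exp (- (norm x)\<^sup>2 / (4 * \<xi>)))\<^sup>2 = exp (- (1 / (2 * \<xi>)) * (norm x)\<^sup>2)"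
          using \<xi> by (simp add: exp_double[symmetric])
        then show "ennreal ((\<xi> powr (- 3 / 4) / (2 * pi) * cmod (u (t - \<xi>)) * exp (- (norm x)\<^sup>2 / (4 * \<xi>)))\<^sup>2) =
           ennreal ?c * ennreal (exp (- (1 / (2 * \<xi>)) * (norm x)\<^sup>2))"
          by (simp only: power_mult_distrib[of _ "exp _"] ennreal_mult zero_le_power2 exp_ge_zero)
      qed
      also have "\<dots> = ennreal ?c * ennreal (pi / (1 / (2 * \<xi>)))"
        using \<xi> by (subst nn_integral_cmult) (simp, subst nn_integral_gaussian_plane, simp_all)
      also have "\<dots> = ennreal (?c * (2 * \<xi> * pi))"
        using \<xi> by (simp add: ennreal_mult[symmetric] mult.commute)
      also have "?c * (2 * \<xi> * pi) = \<xi> powr (- 1 / 2) / (2 * pi) * (cmod (u (t - \<xi>)))\<^sup>2"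
      proof -
        have "(\<xi> powr (- 3 / 4))\<^sup>2 * \<xi> = \<xi> powr (- 1 / 2)"
          using \<xi> powr_add[of \<xi> "- 3 / 2" 1] by (simp add: powr_power)
        then have "?c * (2 * \<xi> * pi) = \<xi> powr (- 1 / 2) * (2 * pi) * ((cmod (u (t - \<xi>)))\<^sup>2 / (2 * pi)\<^sup>2)"
          by (simp add: power_mult_distrib power_divide mult.commute[of \<xi>])
        then show ?thesis by (simp add: power2_eq_square)
      qed
      finally show ?thesis by simp
    qed
  next
    show "(\<integral>\<^sup>+\<xi>. ennreal ((\<xi> powr (- 1 / 4))\<^sup>2) \<partial>?N) \<le> ennreal (2 * sqrt t)"
    proof -
      have "(\<xi> powr (- 1 / 4))\<^sup>2 = \<xi> powr (- 1 / 2)" for \<xi> :: real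
        by (cases "\<xi> = 0") (simp_all add: powr_power)
      then show ?thesis using nn_integral_inverse_sqrt[OF t(1)] by (simp only: order_refl)
    qed
  qed measurable
  also have "(\<integral>\<^sup>+\<xi>. ennreal (\<xi> powr (- 1 / 2) / (2 * pi) * (cmod (u (t - \<xi>)))\<^sup>2) \<partial>?N) \<le>
      (\<integral>\<^sup>+\<xi>. ennreal (?K\<^sup>2 / (2 * pi)) * ennreal (\<xi> powr (- 1 / 2)) \<partial>?N)"
  proof (intro nn_integral_mono_AE eventually_mono[OF time_reversal(2)])
    fix \<xi> assume "cmod (u (t - \<xi>)) \<le> ?K"
    then have "\<xi> powr (- 1 / 2) / (2 * pi) * (cmod (u (t - \<xi>)))\<^sup>2 \<le> \<xi> powr (- 1 / 2) / (2 * pi) * ?K\<^sup>2"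
      by (intro mult_left_mono power_mono) auto
    then show "ennreal (\<xi> powr (- 1 / 2) / (2 * pi) * (cmod (u (t - \<xi>)))\<^sup>2) \<le> ennreal (?K\<^sup>2 / (2 * pi)) * ennreal (\<xi> powr (- 1 / 2))"
      by (simp add: ennreal_mult[symmetric] mult.commute)
  qed
  also have "\<dots> = ennreal (?K\<^sup>2 / (2 * pi)) * ennreal (2 * sqrt t)"
    by (subst nn_integral_cmult) (simp_all only: nn_integral_inverse_sqrt[OF t(1)], measurable)
  \<comment> \<open>The integral of \<xi>^(-1/2) occurs twice: 2 sqrt t * K^2 / (2 pi) * 2 sqrt
    t.\<close>
  also have "ennreal (2 * sqrt t) * \<dots> = ennreal (2 * t / pi * ?K\<^sup>2)"
    using t by (simp add: ennreal_mult[symmetric] field_simps)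
  finally show ?thesis by (simp add: W_ctrl_eq mult_left_mono)
qed

lemma W_ctrl_H_rad: "W_ctrl u t \<in> H_rad"
  and W_ctrl_norm: "L2_norm lebesgue (W_ctrl u t) \<le> sqrt (2 * t / pi * (Linf_norm (lebesgue_on {0<..<T}) u)\<^sup>2)"
proof -
  note [measurable] = ctrl_measurable
  have eq: "W_ctrl u t = (\<lambda>x. LINT \<xi>|lebesgue_on {0<..<t}. ctrl_kernel ((norm x)\<^sup>2) \<xi>)"
    by (simp add: W_ctrl_eq fun_eq_iff)
  have "W_ctrl u t \<in> borel_measurable borel" unfolding eq by measurable
  note L2 = L2I[OF this nn_integral_W_ctrl_le]
  show "W_ctrl u t \<in> H_rad"
    using L2(1) t unfolding eq by (intro H_radI ctrl_measurable) auto
  show "L2_norm lebesgue (W_ctrl u t) \<le> sqrt (2 * t / pi * (Linf_norm (lebesgue_on {0<..<T}) u)\<^sup>2)"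
    using t by (intro L2(2)) auto
qed

text \<open>The bound with sqrt (2 t / pi) is sharper; it is relaxed through sqrt (2 t) \<le> 2 (t +
  1). Positivity of \<open>T\<close> makes (0,T) non-null, so the essential norm is nonnegative and
  may multiply this inequality.\<close>

lemma W_ctrl_norm_le:
  assumes T: "T > 0"
  shows "L2_norm lebesgue (W_ctrl u t) \<le> 2 / sqrt pi * (t + 1) * Linf_norm (lebesgue_on {0<..<T}) u"
proof -
  let ?K = "Linf_norm (lebesgue_on {0<..<T}) u"
  have K: "?K \<ge> 0"
    by (rule Linf_norm_nonneg[OF u]) (use T in \<open>simp add: emeasure_restrict_space\<close>)
  have "2 * t \<le> (2 * (t + 1))\<^sup>2"
    using t by (simp add: power2_eq_square algebra_simps)
  then have "sqrt (2 * t) \<le> 2 * (t + 1)"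
    using t by (intro real_le_lsqrt) auto
  then have "sqrt (2 * t) / sqrt pi * ?K \<le> 2 * (t + 1) / sqrt pi * ?K"
    by (intro mult_right_mono divide_right_mono K) auto
  then show ?thesis
    using W_ctrl_norm K by (simp add: real_sqrt_mult real_sqrt_divide)
qed

end

section \<open>Polynomials times Gaussians\<close>

lemma real_polynomial_function_derivative:
  assumes "real_polynomial_function p"
  shows "\<exists>p'. (\<forall>v. real_polynomial_function (\<lambda>x. p' x v)) \<and> (\<forall>x. (p has_derivative p' x) (at x))"
  using assms
proof induction
  case (linear f)
  then show ?case
    by (intro exI[of _ "\<lambda>x. f"]) (auto intro: bounded_linear_imp_has_derivative)
next
  case (const c)
  show ?case by (intro exI[of _ "\<lambda>x v. 0"]) auto
next
  case (add f g)
  then obtain f' g' where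
    "\<forall>v. real_polynomial_function (\<lambda>x. f' x v)" "\<forall>x. (f has_derivative f' x) (at x)"
    "\<forall>v. real_polynomial_function (\<lambda>x. g' x v)" "\<forall>x. (g has_derivative g' x) (at x)" by blast
  then show ?case
    by (intro exI[of _ "\<lambda>x v. f' x v + g' x v"]) (auto intro: has_derivative_add)
next
  case (mult f g)
  then obtain f' g' where f': "\<And>v. real_polynomial_function (\<lambda>x. f' x v)" "\<And>x. (f has_derivative f' x) (at x)"
    and g': "\<And>v. real_polynomial_function (\<lambda>x. g' x v)" "\<And>x. (g has_derivative g' x) (at x)" by blast
  show ?case
    by (intro exI[of _ "\<lambda>x v. f x * g' x v + f' x v * g x"] conjI allI has_derivative_mult f' g'
        real_polynomial_function.intros(3,4) mult.hyps)
qed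

lemma real_polynomial_function_le_exp:
  assumes "real_polynomial_function p" and "e > 0"
  shows "\<exists>C\<ge>0. \<forall>x. \<bar>p x\<bar> \<le> C * exp (e * (norm x)\<^sup>2)"
  using assms
proof (induction arbitrary: e)
  case (linear f)
  then obtain K where K: "K \<ge> 0" "\<And>x. \<bar>f x\<bar> \<le> norm x * K"
    by (metis bounded_linear.nonneg_bounded real_norm_def)
  \<comment> \<open>The factor 1 + 1/e is chosen so that (1 + 1/e)(1 + e s) \<ge> 1 + s for s =
    |x|^2; then 1 + e s \<le> exp (e s).\<close>
  have "\<bar>f x\<bar> \<le> (K * (1 + 1 / e)) * exp (e * (norm x)\<^sup>2)" for x
  proof -
    have "2 * norm x \<le> 1 + (norm x)\<^sup>2"
      using sum_squares_bound[of 1 "norm x"] by simp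
    then have "norm x \<le> 1 + (norm x)\<^sup>2"
      using norm_ge_zero[of x] by linarith
    also have "\<dots> \<le> (1 + 1 / e) * (1 + e * (norm x)\<^sup>2)"
      using linear.prems by (simp add: field_simps)
    also have "\<dots> \<le> (1 + 1 / e) * exp (e * (norm x)\<^sup>2)"
      using linear.prems by (intro mult_left_mono exp_ge_add_one_self) auto
    finally have "norm x * K \<le> (1 + 1 / e) * exp (e * (norm x)\<^sup>2) * K"
      using K(1) by (rule mult_right_mono)
    with K(2)[of x] show ?thesis by (simp add: mult_ac)
  qed
  then show ?case
    using K(1) linear.prems by (intro exI[of _ "K * (1 + 1 / e)"]) auto
next
  case (const c)
  then show ?case by (intro exI[of _ "\<bar>c\<bar>"]) (auto simp: mult_le_cancel_left1)
next
  case (add f g)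
  then obtain C D where "C \<ge> 0" "D \<ge> 0" "\<And>x. \<bar>f x\<bar> \<le> C * exp (e * (norm x)\<^sup>2)" "\<And>x. \<bar>g x\<bar> \<le> D * exp (e * (norm x)\<^sup>2)"
    by metis
  then show ?case
    by (intro exI[of _ "C + D"]) (auto simp: distrib_right intro!: order_trans[OF abs_triangle_ineq] add_mono)
next
  case (mult f g)
  \<comment> \<open>Exponents add in a product, so each factor is estimated with half the rate; this
    is why the induction keeps \<open>e\<close> arbitrary.\<close>
  then have "e / 2 > 0" by simp
  with mult.IH obtain C D where CD: "C \<ge> 0" "D \<ge> 0" "\<And>x. \<bar>f x\<bar> \<le> C * exp (e / 2 * (norm x)\<^sup>2)" "\<And>x. \<bar>g x\<bar> \<le> D * exp (e / 2 * (norm x)\<^sup>2)"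
    by metis
  have "\<bar>f x * g x\<bar> \<le> C * D * exp (e * (norm x)\<^sup>2)" for x
  proof -
    have "\<bar>f x * g x\<bar> \<le> (C * exp (e / 2 * (norm x)\<^sup>2)) * (D * exp (e / 2 * (norm x)\<^sup>2))"
      unfolding abs_mult by (intro mult_mono CD) (use CD in auto)
    also have "\<dots> = C * D * exp (e / 2 * (norm x)\<^sup>2 + e / 2 * (norm x)\<^sup>2)"
      unfolding exp_add by (simp only: mult_ac)
    finally show ?thesis by simp
  qed
  then show ?case using CD by (intro exI[of _ "C * D"]) auto
qed

text \<open>Differentiation changes the polynomial but not the rate \<open>c\<close>, so one class
  serves derivatives of all orders.\<close>

definition gaussian_polynomials :: "real \<Rightarrow> ('a::euclidean_space \<Rightarrow> real) set" where
  "gaussian_polynomials c = {\<lambda>x. p x * exp (- c * (norm x)\<^sup>2) | p. real_polynomial_function p}"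

text \<open>Half of the decay absorbs the growth of the polynomial.\<close>

lemma gaussian_polynomials_bound:
  assumes "k \<in> gaussian_polynomials c" and "c > 0"
  shows "\<exists>C\<ge>0. \<forall>x. \<bar>k x\<bar> \<le> C * exp (- (c / 2) * (norm x)\<^sup>2)"
proof -
  obtain p where p: "real_polynomial_function p" "k = (\<lambda>x. p x * exp (- c * (norm x)\<^sup>2))"
    using assms by (auto simp: gaussian_polynomials_def)
  obtain C where C: "C \<ge> 0" "\<And>x. \<bar>p x\<bar> \<le> C * exp (c / 2 * (norm x)\<^sup>2)"
    using real_polynomial_function_le_exp[OF p(1), of "c / 2"] assms(2) by auto
  have "\<bar>k x\<bar> \<le> C * exp (- (c / 2) * (norm x)\<^sup>2)" for x
  proof -
    have "\<bar>k x\<bar> \<le> (C * exp (c / 2 * (norm x)\<^sup>2)) * exp (- c * (norm x)\<^sup>2)"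
      unfolding p(2) abs_mult using C(2)[of x] by simp
    also have "\<dots> = C * exp (c / 2 * (norm x)\<^sup>2 + - c * (norm x)\<^sup>2)"
      unfolding exp_add by (simp only: mult_ac)
    also have "c / 2 * (norm x)\<^sup>2 + - c * (norm x)\<^sup>2 = - (c / 2) * (norm x)\<^sup>2"
      by (simp add: algebra_simps)
    finally show ?thesis .
  qed
  with C(1) show ?thesis by auto
qed

lemma gaussian_polynomials_derivative:
  fixes k :: "'a::euclidean_space \<Rightarrow> real"
  assumes "k \<in> gaussian_polynomials c"
  obtains k' where "\<And>v. (\<lambda>x. k' x v) \<in> gaussian_polynomials c" "\<And>x. (k has_derivative k' x) (at x)"
proof -
  obtain p where p: "real_polynomial_function p" "k = (\<lambda>x. p x * exp (- c * (norm x)\<^sup>2))"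
    using assms by (auto simp: gaussian_polynomials_def)
  obtain p' where p': "\<And>v. real_polynomial_function (\<lambda>x. p' x v)" "\<And>x. (p has_derivative p' x) (at x)"
    using real_polynomial_function_derivative[OF p(1)] by blast
  \<comment> \<open>Product rule: differentiating the Gaussian along \<open>v\<close> produces a
    factor linear in \<open>x\<close>.\<close>
  let ?k' = "\<lambda>x v. (p' x v + p x * (- 2 * c * (x \<bullet> v))) * exp (- c * (norm x)\<^sup>2)"
  show thesis
  proof (rule that)
    fix v
    have "real_polynomial_function (\<lambda>x. p' x v + p x * (- 2 * c * (x \<bullet> v)))"
      by (intro real_polynomial_function.intros p p' bounded_linear_inner_left)
    then show "(\<lambda>x. ?k' x v) \<in> gaussian_polynomials c"
      by (auto simp: gaussian_polynomials_def)
  next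
    fix x
    show "(k has_derivative ?k' x) (at x)"
      unfolding p(2) power2_norm_eq_inner
      by (rule derivative_eq_intros p' refl | simp add: algebra_simps inner_commute)+
  qed
qed

section \<open>Differentiation under the convolution integral\<close>

text \<open>From |z| \<le> |w| + 1 follows |z|^2 \<le> 2 |w|^2 + 2. At the cost of half the rate and
  a constant, this makes a Gaussian bound uniform over a unit ball, as needed to dominate difference
  quotients.\<close>

lemma gaussian_shift_le:
  fixes z w :: "'a::real_normed_vector"
  assumes "norm (w - z) \<le> 1" and "b \<ge> 0"
  shows "exp (- b * (norm w)\<^sup>2) \<le> exp b * exp (- (b / 2) * (norm z)\<^sup>2)"
proof -
  have "norm z \<le> norm w + 1"
    using norm_triangle_ineq4[of w "w - z"] assms(1) by simp
  then have "(norm z)\<^sup>2 \<le> (norm w + 1)\<^sup>2" by (intro power_mono) auto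
  also have "\<dots> \<le> 2 * (norm w)\<^sup>2 + 2"
    using sum_squares_bound[of "norm w" 1] by (simp add: power2_sum)
  finally have "b * (norm z)\<^sup>2 \<le> b * (2 * (norm w)\<^sup>2 + 2)" using assms(2) by (rule mult_left_mono)
  then show ?thesis by (simp add: exp_add[symmetric] algebra_simps)
qed

text \<open>Integrability is assumed for every rate, since the domination arguments lower the rate
  of decay.\<close>

locale gaussian_convolution =
  fixes W :: "'a::euclidean_space \<Rightarrow> 'b::{banach,second_countable_topology}"
  assumes W_measurable[measurable]: "W \<in> borel_measurable lebesgue"
    and W_integrable: "\<And>c x. c > 0 \<Longrightarrow> integrable lebesgue (\<lambda>y. exp (- c * (norm (x - y))\<^sup>2) *\<^sub>R W y)"
begin

definition conv :: "('a \<Rightarrow> real) \<Rightarrow> 'a \<Rightarrow> 'b" where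
  "conv k x = (LINT y|lebesgue. k (x - y) *\<^sub>R W y)"

lemma measurable_kernel:
  assumes [measurable]: "k \<in> borel_measurable borel"
  shows "(\<lambda>y. k (x - y) *\<^sub>R W y) \<in> borel_measurable lebesgue"
proof -
  have [measurable]: "(\<lambda>y. y) \<in> lebesgue \<rightarrow>\<^sub>M (borel :: 'a measure)"
    by (rule measurable_completion) simp
  show ?thesis by measurable
qed

lemma integrable_kernel:
  assumes k: "k \<in> borel_measurable borel" and b: "b > 0"
    and bound: "\<And>z. \<bar>k z\<bar> \<le> C * exp (- b * (norm z)\<^sup>2)"
  shows "integrable lebesgue (\<lambda>y. k (x - y) *\<^sub>R W y)"
proof (rule Bochner_Integration.integrable_bound[OF _ measurable_kernel[OF k]])
  show "integrable lebesgue (\<lambda>y. C *\<^sub>R exp (- b * (norm (x - y))\<^sup>2) *\<^sub>R W y)"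
    by (intro integrable_scaleR_right W_integrable b)
  show "AE y in lebesgue. norm (k (x - y) *\<^sub>R W y) \<le> norm (C *\<^sub>R exp (- b * (norm (x - y))\<^sup>2) *\<^sub>R W y)"
  proof (intro always_eventually allI)
    fix y
    have "\<bar>k (x - y)\<bar> \<le> \<bar>C\<bar> * exp (- b * (norm (x - y))\<^sup>2)"
      by (rule order_trans[OF bound]) (simp add: abs_ge_self)
    then have "\<bar>k (x - y)\<bar> * norm (W y) \<le> \<bar>C\<bar> * exp (- b * (norm (x - y))\<^sup>2) * norm (W y)"
      by (rule mult_right_mono) simp
    then show "norm (k (x - y) *\<^sub>R W y) \<le> norm (C *\<^sub>R exp (- b * (norm (x - y))\<^sup>2) *\<^sub>R W y)"
      by (simp add: abs_mult mult.assoc)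
  qed
qed

text \<open>The difference quotient minus the derivative tends to 0 under the integral by
  differentiability of \<open>k\<close>, and for small increments it is dominated by a Gaussian
  times |W|.\<close>

lemma has_derivative_conv:
  assumes k: "\<And>z. (k has_derivative k' z) (at z)"
    and k'_meas: "\<And>v. (\<lambda>z. k' z v) \<in> borel_measurable borel"
    and b: "b > 0" and C: "C \<ge> 0" "C' \<ge> 0"
    and bound: "\<And>z. \<bar>k z\<bar> \<le> C * exp (- b * (norm z)\<^sup>2)"
    and bound': "\<And>z v. \<bar>k' z v\<bar> \<le> C' * exp (- b * (norm z)\<^sup>2) * norm v"
  shows "(conv k has_derivative (\<lambda>v. conv (\<lambda>z. k' z v) x)) (at x)"
proof -
  have k_meas: "k \<in> borel_measurable borel"
    by (intro borel_measurable_continuous_onI continuous_at_imp_continuous_on ballI has_derivative_continuous[OF k])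
  note int = integrable_kernel[OF k_meas b bound]
  have int': "integrable lebesgue (\<lambda>y. k' (x - y) v *\<^sub>R W y)" for v
    by (rule integrable_kernel[where k="\<lambda>z. k' z v" and C="C' * norm v", OF k'_meas b])
      (use bound' in \<open>simp add: mult_ac\<close>)
  have lin: "linear (k' z)" for z
    using k[of z] by (simp add: has_derivative_linear)
  have blin: "bounded_linear (\<lambda>v. conv (\<lambda>z. k' z v) x)"
    unfolding linear_conv_bounded_linear[symmetric] conv_def
  proof (rule linearI)
    show "(LINT y|lebesgue. k' (x - y) (v + w) *\<^sub>R W y) =
        (LINT y|lebesgue. k' (x - y) v *\<^sub>R W y) + (LINT y|lebesgue. k' (x - y) w *\<^sub>R W y)" for v w
      using int' by (simp add: linear_add[OF lin] scaleR_add_left)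
    show "(LINT y|lebesgue. k' (x - y) (r *\<^sub>R v) *\<^sub>R W y) = r *\<^sub>R (LINT y|lebesgue. k' (x - y) v *\<^sub>R W y)" for r v
      by (simp add: linear_scale[OF lin] scaleR_scaleR[symmetric] del: scaleR_scaleR)
  qed
  \<comment> \<open>The summand with \<open>exp b\<close> comes from the mean value inequality on
    the unit ball around \<open>z\<close>; the 1 comes from the linear term
    \<open>k' z h\<close>.\<close>
  have remainder: "\<bar>k (z + h) - k z - k' z h\<bar> \<le> C' * (exp b + 1) * exp (- (b / 2) * (norm z)\<^sup>2) * norm h"
    if h: "norm h \<le> 1" for z h
  proof -
    let ?B = "C' * (exp b * exp (- (b / 2) * (norm z)\<^sup>2))"
    have "norm (k (z + h) - k z) \<le> ?B * norm (z + h - z)"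
    proof (rule differentiable_bound[where S="cball z 1" and f'=k'])
      show "(k has_derivative k' w) (at w within cball z 1)" for w
        by (rule has_derivative_at_withinI[OF k])
      fix w assume "w \<in> cball z 1"
      then have w: "norm (w - z) \<le> 1" by (simp add: dist_norm norm_minus_commute)
      show "onorm (k' w) \<le> ?B"
      proof (rule onorm_bound)
        fix v
        have "\<bar>k' w v\<bar> \<le> C' * exp (- b * (norm w)\<^sup>2) * norm v" by (rule bound')
        also have "\<dots> \<le> ?B * norm v"
          using C b by (intro mult_right_mono mult_left_mono gaussian_shift_le w) auto
        finally show "norm (k' w v) \<le> ?B * norm v" by simp
      qed (use C in auto)
    qed (use h in \<open>auto simp: dist_norm\<close>)
    then have "\<bar>k (z + h) - k z\<bar> \<le> ?B * norm h" by simp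
    moreover have "\<bar>k' z h\<bar> \<le> C' * exp (- (b / 2) * (norm z)\<^sup>2) * norm h"
    proof -
      have "exp (- b * (norm z)\<^sup>2) \<le> exp (- (b / 2) * (norm z)\<^sup>2)"
        using b by simp
      then have "C' * exp (- b * (norm z)\<^sup>2) * norm h \<le> C' * exp (- (b / 2) * (norm z)\<^sup>2) * norm h"
        using C by (intro mult_right_mono mult_left_mono) auto
      with bound'[of z h] show ?thesis by linarith
    qed
    ultimately have "\<bar>k (z + h) - k z - k' z h\<bar> \<le> ?B * norm h + C' * exp (- (b / 2) * (norm z)\<^sup>2) * norm h"
      by linarith
    then show ?thesis by (simp add: algebra_simps)
  qed
  let ?q = "\<lambda>h y. ((k (x - y + h) - k (x - y) - k' (x - y) h) / norm h) *\<^sub>R W y"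
  have quot: "norm (conv k (x + h) - conv k x - conv (\<lambda>z. k' z h) x) / norm h = norm (LINT y|lebesgue. ?q h y)" for h
  proof -
    have "conv k (x + h) - conv k x - conv (\<lambda>z. k' z h) x =
        (LINT y|lebesgue. (k (x - y + h) - k (x - y) - k' (x - y) h) *\<^sub>R W y)"
      using int int[of "x + h"] int' by (simp add: conv_def scaleR_diff_left add_diff_eq diff_add_eq)
    moreover have "?q h = (\<lambda>y. (1 / norm h) *\<^sub>R ((k (x - y + h) - k (x - y) - k' (x - y) h) *\<^sub>R W y))"
      by auto
    then have "(LINT y|lebesgue. ?q h y) = (1 / norm h) *\<^sub>R (LINT y|lebesgue. (k (x - y + h) - k (x - y) - k' (x - y) h) *\<^sub>R W y)"
      by (simp only: integral_scaleR_right)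
    ultimately show ?thesis by simp
  qed
  \<comment> \<open>Restricting to |h| < 1 makes \<open>remainder\<close> applicable, and passing to
    sequences makes dominated convergence applicable.\<close>
  have "((\<lambda>h. norm (LINT y|lebesgue. ?q h y)) \<longlongrightarrow> 0) (at 0 within ball 0 1)"
    unfolding tendsto_at_iff_sequentially
  proof (intro allI impI)
    fix X :: "nat \<Rightarrow> 'a"
    assume X: "\<forall>i. X i \<in> ball 0 1 - {0}" and X0: "X \<longlonglongrightarrow> 0"
    have "(\<lambda>i. LINT y|lebesgue. ?q (X i) y) \<longlonglongrightarrow> (LINT y|(lebesgue :: 'a measure). (0::'b))"
    proof (rule integral_dominated_convergence[where s="\<lambda>i. ?q (X i)"])
      show "integrable lebesgue (\<lambda>y. norm ((C' * (exp b + 1)) *\<^sub>R exp (- (b / 2) * (norm (x - y))\<^sup>2) *\<^sub>R W y))"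
        using b by (intro integrable_norm integrable_scaleR_right W_integrable) simp
      show "?q (X i) \<in> borel_measurable lebesgue" for i
        using measurable_kernel[of "\<lambda>z. (k (z + X i) - k z - k' z (X i)) / norm (X i)" x] k_meas k'_meas by simp
      show "AE y in lebesgue. norm (?q (X i) y) \<le> norm ((C' * (exp b + 1)) *\<^sub>R exp (- (b / 2) * (norm (x - y))\<^sup>2) *\<^sub>R W y)" for i
      proof (intro always_eventually allI)
        fix y
        let ?r = "k (x - y + X i) - k (x - y) - k' (x - y) (X i)"
        have "norm (X i) \<le> 1" "norm (X i) > 0" using X by (auto simp: less_imp_le)
        with remainder[of "X i" "x - y"]
        have "\<bar>?r\<bar> / norm (X i) \<le> C' * (exp b + 1) * exp (- (b / 2) * (norm (x - y))\<^sup>2)"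
          by (simp add: pos_divide_le_eq)
        then have "\<bar>?r\<bar> / norm (X i) * norm (W y) \<le> C' * (exp b + 1) * exp (- (b / 2) * (norm (x - y))\<^sup>2) * norm (W y)"
          by (rule mult_right_mono) simp
        also have "\<dots> = norm ((C' * (exp b + 1)) *\<^sub>R exp (- (b / 2) * (norm (x - y))\<^sup>2) *\<^sub>R W y)"
          using C by (simp add: abs_mult mult.assoc)
        finally show "norm (?q (X i) y) \<le> norm ((C' * (exp b + 1)) *\<^sub>R exp (- (b / 2) * (norm (x - y))\<^sup>2) *\<^sub>R W y)"
          by simp
      qed
      show "AE y in lebesgue. (\<lambda>i. ?q (X i) y) \<longlonglongrightarrow> 0"
      proof (intro always_eventually allI)
        fix y
        have "((\<lambda>h. norm (k (x - y + h) - k (x - y) - k' (x - y) h) / norm h) \<longlongrightarrow> 0) (at 0)"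
          using k[of "x - y"] by (simp add: has_derivative_at)
        then have "((\<lambda>h. (k (x - y + h) - k (x - y) - k' (x - y) h) / norm h) \<longlongrightarrow> 0) (at 0)"
          by (subst tendsto_norm_zero_iff[symmetric]) simp
        moreover have "filterlim X (at 0) sequentially"
          using X X0 by (auto simp: filterlim_at)
        ultimately have "(\<lambda>i. (k (x - y + X i) - k (x - y) - k' (x - y) (X i)) / norm (X i)) \<longlonglongrightarrow> 0"
          by (rule filterlim_compose)
        from tendsto_scaleR[OF this tendsto_const[of "W y"]]
        show "(\<lambda>i. ?q (X i) y) \<longlonglongrightarrow> 0" by simp
      qed
    qed simp
    then show "((\<lambda>h. norm (LINT y|lebesgue. ?q h y)) \<circ> X) \<longlonglongrightarrow> 0"
      by (simp add: o_def tendsto_norm_zero)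
  qed
  then have "((\<lambda>h. norm (LINT y|lebesgue. ?q h y)) \<longlongrightarrow> 0) (at 0)"
    by (simp add: at_within_open[of 0 "ball 0 1"])
  then show ?thesis
    unfolding has_derivative_at quot using blin by blast
qed

lemma conv_derivative:
  assumes k: "k \<in> gaussian_polynomials c" and c: "c > 0"
  obtains k' where "\<And>v. (\<lambda>x. k' x v) \<in> gaussian_polynomials c"
    and "\<And>x. (conv k has_derivative (\<lambda>v. conv (\<lambda>z. k' z v) x)) (at x)"
proof -
  obtain k' where k': "\<And>v. (\<lambda>x. k' x v) \<in> gaussian_polynomials c" "\<And>x. (k has_derivative k' x) (at x)"
    using gaussian_polynomials_derivative[OF k] by blast
  obtain C where C: "C \<ge> 0" "\<And>x. \<bar>k x\<bar> \<le> C * exp (- (c / 2) * (norm x)\<^sup>2)"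
    using gaussian_polynomials_bound[OF k c] by blast
  have "\<exists>D. \<forall>v. D v \<ge> 0 \<and> (\<forall>x. \<bar>k' x v\<bar> \<le> D v * exp (- (c / 2) * (norm x)\<^sup>2))"
    using gaussian_polynomials_bound[OF k'(1) c] by (intro choice) blast
  then obtain D where D: "\<And>v. D v \<ge> 0" "\<And>v x. \<bar>k' x v\<bar> \<le> D v * exp (- (c / 2) * (norm x)\<^sup>2)"
    by blast
  \<comment> \<open>Each directional derivative lies in the same class, so it is itself
    differentiable; its continuity yields the measurability required below.\<close>
  have cont: "continuous_on UNIV (\<lambda>x. k' x v)" for v
  proof -
    obtain k'' where "\<And>x. ((\<lambda>x. k' x v) has_derivative k'' x) (at x)"
      using gaussian_polynomials_derivative[OF k'(1)[of v]] by blast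
    then show ?thesis
      using has_derivative_continuous by (fastforce simp: continuous_on_eq_continuous_at)
  qed
  show thesis
  proof (rule that[OF k'(1) has_derivative_conv[OF k'(2) _ _ C(1) _ C(2)]])
    show "(\<lambda>x. k' x v) \<in> borel_measurable borel" for v
      by (rule borel_measurable_continuous_onI[OF cont])
    show "c / 2 > 0" using c by simp
    show "(\<Sum>b\<in>Basis. D b) \<ge> 0" by (intro sum_nonneg D)
    \<comment> \<open>The bounds \<open>D v\<close> are not yet uniform in the direction. Expanding
      \<open>v\<close> in the basis gives a bound proportional to |v|, with the sum of the basis
      constants.\<close>
    show "\<bar>k' z v\<bar> \<le> (\<Sum>b\<in>Basis. D b) * exp (- (c / 2) * (norm z)\<^sup>2) * norm v" for z v
    proof -
      have lin: "linear (k' z)" using k'(2)[of z] by (simp add: has_derivative_linear)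
      have "k' z v = k' z (\<Sum>b\<in>Basis. (v \<bullet> b) *\<^sub>R b)" by (simp add: euclidean_representation)
      also have "\<dots> = (\<Sum>b\<in>Basis. (v \<bullet> b) * k' z b)"
        by (simp add: linear_sum[OF lin] linear_scale[OF lin])
      finally have "\<bar>k' z v\<bar> \<le> (\<Sum>b\<in>Basis. \<bar>v \<bullet> b\<bar> * \<bar>k' z b\<bar>)"
        by (simp add: abs_mult[symmetric] sum_abs)
      also have "\<dots> \<le> (\<Sum>b\<in>Basis. norm v * (D b * exp (- (c / 2) * (norm z)\<^sup>2)))"
        by (intro sum_mono mult_mono Basis_le_norm D) auto
      also have "\<dots> = (\<Sum>b\<in>Basis. D b) * exp (- (c / 2) * (norm z)\<^sup>2) * norm v"
        by (simp only: sum_distrib_left[symmetric] sum_distrib_right[symmetric] mult_ac)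
      finally show ?thesis .
    qed
  qed
qed

text \<open>Directional derivatives of the convolution are convolutions with kernels from the same
  class, so the induction on the order runs over all \<open>k\<close> at once.\<close>

lemma conv_Ck: "k \<in> gaussian_polynomials c \<Longrightarrow> c > 0 \<Longrightarrow> conv k \<in> Ck n"
proof (induction n arbitrary: k)
  case 0
  obtain k' where "\<And>x. (conv k has_derivative (\<lambda>v. conv (\<lambda>z. k' z v) x)) (at x)"
    using conv_derivative[OF 0] by blast
  then have "continuous (at x) (conv k)" for x by (rule has_derivative_continuous)
  then show ?case by (simp add: continuous_on_eq_continuous_at)
next
  case (Suc n)
  obtain k' where k': "\<And>v. (\<lambda>x. k' x v) \<in> gaussian_polynomials c"
    "\<And>x. (conv k has_derivative (\<lambda>v. conv (\<lambda>z. k' z v) x)) (at x)"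
    using conv_derivative[OF Suc.prems] by blast
  have "frechet_derivative (conv k) (at x) = (\<lambda>v. conv (\<lambda>z. k' z v) x)" for x
    by (rule frechet_derivative_at[OF k'(2), symmetric])
  moreover have "conv (\<lambda>z. k' z v) \<in> Ck n" for v
    by (rule Suc.IH[OF k'(1) Suc.prems(2)])
  ultimately show ?case using k'(2) by (auto simp: differentiable_def)
qed

lemma conv_Cinf: "k \<in> gaussian_polynomials c \<Longrightarrow> c > 0 \<Longrightarrow> conv k \<in> Cinf"
  by (simp add: Cinf_def conv_Ck)

end

section \<open>Smoothness of the free evolution and assembly of the claims\<close>

text \<open>The product of a Gaussian and |W| is at most the sum of their squares. The square of the
  Gaussian is the Gaussian of rate 2 c, which is integrable.\<close>

lemma gaussian_convolution_L2:
  fixes W :: "real^2 \<Rightarrow> complex"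
  assumes W: "W \<in> L2 lebesgue"
  shows "gaussian_convolution W"
proof
  show m: "W \<in> borel_measurable lebesgue" using W by (simp add: L2_def)
  fix c :: real and x :: "real^2"
  assume c: "c > 0"
  have [measurable]: "(\<lambda>y. y) \<in> lebesgue \<rightarrow>\<^sub>M (borel :: (real^2) measure)"
    by (rule measurable_completion) simp
  have "(\<integral>\<^sup>+y. ennreal (exp (- (2 * c) * (norm (x - y))\<^sup>2)) \<partial>lborel) =
      (\<integral>\<^sup>+z. ennreal (exp (- (2 * c) * (norm z)\<^sup>2)) \<partial>distr lborel borel (\<lambda>y. x - y))"
    by (subst nn_integral_distr) auto
  also have "\<dots> = ennreal (pi / (2 * c))"
    unfolding distr_lborel_reflect_affine by (rule nn_integral_gaussian_plane) (use c in simp)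
  finally have "integrable lebesgue (\<lambda>y. exp (- (2 * c) * (norm (x - y))\<^sup>2))"
    by (intro integrableI_bounded) (auto simp: nn_integral_completion)
  moreover have "integrable lebesgue (\<lambda>y. (cmod (W y))\<^sup>2)" using W by (simp add: L2_def)
  ultimately have "integrable lebesgue (\<lambda>y. exp (- (2 * c) * (norm (x - y))\<^sup>2) + (cmod (W y))\<^sup>2)"
    by (rule Bochner_Integration.integrable_add)
  then show "integrable lebesgue (\<lambda>y. exp (- c * (norm (x - y))\<^sup>2) *\<^sub>R W y)"
  proof (rule Bochner_Integration.integrable_bound)
    show "(\<lambda>y. exp (- c * (norm (x - y))\<^sup>2) *\<^sub>R W y) \<in> borel_measurable lebesgue"
      using m by measurable
    show "AE y in lebesgue. norm (exp (- c * (norm (x - y))\<^sup>2) *\<^sub>R W y) \<le> norm (exp (- (2 * c) * (norm (x - y))\<^sup>2) + (cmod (W y))\<^sup>2)"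
    proof (intro always_eventually allI)
      fix y
      let ?e = "exp (- c * (norm (x - y))\<^sup>2)"
      have "exp (- (2 * c) * (norm (x - y))\<^sup>2) = ?e\<^sup>2"
        by (simp add: exp_double[symmetric] mult.assoc)
      moreover have "2 * (?e * cmod (W y)) \<le> ?e\<^sup>2 + (cmod (W y))\<^sup>2"
        using sum_squares_bound[of ?e "cmod (W y)"] by (simp only: mult.assoc)
      moreover have "0 \<le> ?e * cmod (W y)" by simp
      ultimately have "?e * cmod (W y) \<le> exp (- (2 * c) * (norm (x - y))\<^sup>2) + (cmod (W y))\<^sup>2" by linarith
      then show "norm (?e *\<^sub>R W y) \<le> norm (exp (- (2 * c) * (norm (x - y))\<^sup>2) + (cmod (W y))\<^sup>2)" by simp
    qed
  qed
qed

lemma W_free_Cinf: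
  assumes W: "W \<in> L2 lebesgue" and t: "t > 0"
  shows "W_free W t \<in> Cinf"
proof -
  interpret gaussian_convolution W by (rule gaussian_convolution_L2[OF W])
  have "heat_kernel_real t = (\<lambda>x. 1 / (4 * pi * t) * exp (- (1 / (4 * t)) * (norm x)\<^sup>2))"
    by (simp add: heat_kernel_real_def fun_eq_iff)
  then have "heat_kernel_real t \<in> gaussian_polynomials (1 / (4 * t))"
    unfolding gaussian_polynomials_def mem_Collect_eq
    \<comment> \<open>The heat kernel is a constant polynomial times the Gaussian of rate 1/(4
      t).\<close>
    by (intro exI[of _ "\<lambda>_. 1 / (4 * pi * t)"] conjI real_polynomial_function.intros(2))
  then have "conv (heat_kernel_real t) \<in> Cinf"
    by (rule conv_Cinf) (use t in simp)
  moreover have "W_free W t = conv (heat_kernel_real t)"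
    using t by (simp add: W_free_def conv_def convolution_heat_kernel fun_eq_iff)
  ultimately show ?thesis by simp
qed

theorem theorem3p4:
  fixes T :: real and u :: "real \<Rightarrow> complex" and W0 :: "real^2 \<Rightarrow> complex"
  assumes "T > 0"
    and "u \<in> Linf (lebesgue_on {0<..<T})"
    and "W0 \<in> H0_hat"
  shows "(\<forall>t\<in>{0..T}. W_free W0 t \<in> H0_hat)
    \<and> (\<forall>t\<in>{0<..T}. W_free W0 t \<in> Cinf)
    \<and> (W0 \<in> H_rad \<longrightarrow> (\<forall>t\<in>{0..T}. W_free W0 t \<in> H_rad))
    \<and> (\<forall>t\<in>{0..T}. W_ctrl u t \<in> H_rad \<and>
         L2_norm lebesgue (W_ctrl u t)
           \<le> 2 / sqrt pi * (t + 1) * Linf_norm (lebesgue_on {0<..<T}) u)"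
proof -
  have "W0 \<in> L2 lebesgue" using assms(3) by (simp add: H0_hat_def)
  moreover have "W_ctrl u t \<in> H_rad" "L2_norm lebesgue (W_ctrl u t)
      \<le> 2 / sqrt pi * (t + 1) * Linf_norm (lebesgue_on {0<..<T}) u" if "t \<in> {0..T}" for t
    using W_ctrl_H_rad[OF _ _ assms(2), of t] W_ctrl_norm_le[OF _ _ assms(2,1), of t] that by auto
  ultimately show ?thesis
    using assms by (auto simp: W_free_H0_hat W_free_Cinf W_free_H_rad simp del: times_divide_eq_left)
qed

end
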